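(* Let $\mathcal{C}\subseteq\mathbb{F}[x_1,\ldots,x_n]$ be a class of polynomials and let $\overline{\mathcal{G}}:\mathbb{F}^\ell\to\mathbb{F}^n$ be a generator for $\mathcal{C}$. Suppose $0\ne h\in\mathbb{F}[\overline{x}]$ has $h\circ\overline{\mathcal{G}}=0$. Then for any nonzero $g\in\mathbb{F}[\overline{x}]$ we have that $g\cdot h\notin\mathcal{C}$.
   Context: $\mathbb{F}$ is a field. A generator for $\mathcal{C}$ with seed length $\ell$ is a polynomial map $\overline{\mathcal{G}}=(\mathcal{G}_1,\ldots,\mathcal{G}_n)$ with $\mathcal{G}_i\in\mathbb{F}[y_1,\ldots,y_\ell]$ such that for all $f\in\mathcal{C}$: $f=0$ in $\mathbb{F}[\overline{x}]$ if and only if $f\circ\overline{\mathcal{G}}=f(\mathcal{G}_1(\overline{y}),\ldots,\mathcal{G}_n(\overline{y}))=0$ in $\mathbb{F}[\overline{y}]$. All identities are as formal polynomials. *)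

theory Defs
  imports "HOL-Library.Poly_Mapping"
begin

text \<open>Formal polynomials in the variables \<open>x\<^sub>1, x\<^sub>2, \<dots>\<close> over \<open>'a\<close>: finitely supported maps from
  monomials (exponent vectors \<open>nat \<Rightarrow>\<^sub>0 nat\<close>) to coefficients, with the convolution product
  of \<open>Poly_Mapping\<close>.\<close>

type_synonym 'a mpoly = "(nat \<Rightarrow>\<^sub>0 nat) \<Rightarrow>\<^sub>0 'a"

text \<open>The ring \<open>F[x\<^sub>1, \<dots>, x\<^sub>n]\<close>; here \<open>keys f\<close> is the set of monomials of \<open>f\<close>, and \<open>keys m\<close>
  is the set of variables of the monomial \<open>m\<close>.\<close>

definition polys :: "nat \<Rightarrow> 'a::zero mpoly set" where
  "polys n = {f. \<forall>m\<in>Poly_Mapping.keys f. Poly_Mapping.keys m \<subseteq> {1..n}}"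

text \<open>\<open>f \<circ> G = f(G\<^sub>1, G\<^sub>2, \<dots>)\<close>, again as a formal polynomial; \<open>Poly_Mapping.single 0 c\<close> is the
  constant polynomial \<open>c\<close>.\<close>

definition poly_comp :: "'a::comm_semiring_1 mpoly \<Rightarrow> (nat \<Rightarrow> 'a mpoly) \<Rightarrow> 'a mpoly" where
  "poly_comp f G =
     (\<Sum>m\<in>Poly_Mapping.keys f.
        Poly_Mapping.single 0 (Poly_Mapping.lookup f m) *
        (\<Prod>i\<in>Poly_Mapping.keys m. G i ^ Poly_Mapping.lookup m i))"

text \<open>Only the components \<open>G 1, \<dots>, G n\<close> are relevant when \<open>C \<subseteq> polys n\<close>.\<close>

definition is_generator ::
  "nat \<Rightarrow> nat \<Rightarrow> 'a::field mpoly set \<Rightarrow> (nat \<Rightarrow> 'a mpoly) \<Rightarrow> bool" where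
  "is_generator n l C G \<longleftrightarrow>
     (\<forall>i\<in>{1..n}. G i \<in> polys l) \<and> (\<forall>f\<in>C. f = 0 \<longleftrightarrow> poly_comp f G = 0)"

end

theory Submission
  imports Defs
begin

text \<open>Substituting \<open>G\<close> is a ring homomorphism, so \<open>g h\<close> vanishes on \<open>G\<close> as soon as \<open>h\<close> does.
  If \<open>g h\<close> were in \<open>C\<close>, the generator property would force \<open>g h = 0\<close>, which is impossible
  because polynomials over a field form an integral domain.\<close>

text \<open>An exponent outside the support is 0 and contributes a factor 1, so all three products
  may run over the union of the two supports, where \<open>power_add\<close> applies factor by
  factor.\<close>

lemma prod_power_lookup_add:
  fixes G :: "'v \<Rightarrow> 'b::comm_semiring_1" and a b :: "'v \<Rightarrow>\<^sub>0 nat"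
  shows "(\<Prod>i\<in>Poly_Mapping.keys (a + b). G i ^ Poly_Mapping.lookup (a + b) i) =
    (\<Prod>i\<in>Poly_Mapping.keys a. G i ^ Poly_Mapping.lookup a i) *
    (\<Prod>i\<in>Poly_Mapping.keys b. G i ^ Poly_Mapping.lookup b i)"
proof -
  let ?S = "Poly_Mapping.keys a \<union> Poly_Mapping.keys b"
  have ext: "(\<Prod>i\<in>Poly_Mapping.keys m. G i ^ Poly_Mapping.lookup m i) =
      (\<Prod>i\<in>?S. G i ^ Poly_Mapping.lookup m i)"
    if "Poly_Mapping.keys m \<subseteq> ?S" for m
    using that by (intro prod.mono_neutral_left) (auto simp: in_keys_iff)
  show ?thesis
    by (subst (1 2 3) ext)
      (auto simp: keys_add lookup_add power_add prod.distrib dest: subsetD[OF keys_add])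
qed

lemma poly_comp_0 [simp]: "poly_comp 0 G = 0"
  by (simp add: poly_comp_def)

text \<open>Cancellation may shrink the support of \<open>f + g\<close>, but this is harmless: each
  summand is additive in its coefficient and vanishes when the coefficient does.\<close>

lemma poly_comp_add: "poly_comp (f + g) G = poly_comp f G + poly_comp g G"
  unfolding poly_comp_def
  by (rule setsum_keys_plus_distrib) (simp_all add: single_add distrib_right)

lemma poly_comp_sum: "poly_comp (\<Sum>i\<in>I. f i) G = (\<Sum>i\<in>I. poly_comp (f i) G)"
  by (induction I rule: infinite_finite_induct) (simp_all add: poly_comp_add)

lemma poly_comp_single:
  "poly_comp (Poly_Mapping.single m c) G =
    Poly_Mapping.single 0 c * (\<Prod>i\<in>Poly_Mapping.keys m. G i ^ Poly_Mapping.lookup m i)"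
  by (simp add: poly_comp_def)

lemma sum_single_lookup:
  "(\<Sum>k\<in>Poly_Mapping.keys f. Poly_Mapping.single k (Poly_Mapping.lookup f k)) = f"
  by (rule poly_mapping_eqI) (auto simp: lookup_sum lookup_single when_def in_keys_iff)

text \<open>Both sides are biadditive in \<open>f\<close> and \<open>g\<close>, so expanding into
  terms reduces the claim to a product of two terms, where exponents add and coefficients
  multiply.\<close>

lemma poly_comp_mult: "poly_comp (f * g) G = poly_comp f G * poly_comp g G"
proof -
  let ?s = "\<lambda>p k. Poly_Mapping.single k (Poly_Mapping.lookup p k)"
  have single: "poly_comp (?s f a * ?s g b) G = poly_comp (?s f a) G * poly_comp (?s g b) G"
    for a b
  proof -
    have "Poly_Mapping.single 0 (Poly_Mapping.lookup f a * Poly_Mapping.lookup g b) =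
        Poly_Mapping.single (0 :: nat \<Rightarrow>\<^sub>0 nat) (Poly_Mapping.lookup f a) *
        Poly_Mapping.single 0 (Poly_Mapping.lookup g b)"
      by (simp add: mult_single)
    then show ?thesis
      unfolding mult_single[of a _ b] poly_comp_single prod_power_lookup_add
      by (simp only: mult_ac)
  qed
  have "poly_comp (f * g) G =
      poly_comp ((\<Sum>a\<in>Poly_Mapping.keys f. ?s f a) * (\<Sum>b\<in>Poly_Mapping.keys g. ?s g b)) G"
    by (simp only: sum_single_lookup)
  also have "\<dots> = poly_comp (\<Sum>a\<in>Poly_Mapping.keys f. ?s f a) G *
      poly_comp (\<Sum>b\<in>Poly_Mapping.keys g. ?s g b) G"
    by (simp only: sum_product poly_comp_sum single)
  finally show ?thesis
    by (simp only: sum_single_lookup)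
qed

theorem lemma6p2:
  fixes n l :: nat
    and C :: "'a::field mpoly set"
    and G :: "nat \<Rightarrow> 'a mpoly"
    and h :: "'a mpoly"
  assumes "C \<subseteq> polys n"
    and "is_generator n l C G"
    and "h \<in> polys n" and "h \<noteq> 0"
    and "poly_comp h G = 0"
  shows "\<forall>g\<in>polys n. g \<noteq> 0 \<longrightarrow> g * h \<notin> C"
proof (intro ballI impI notI)
  fix g :: "'a mpoly"
  assume "g \<noteq> 0" and "g * h \<in> C"
  have "poly_comp (g * h) G = 0"
    by (simp add: poly_comp_mult assms(5))
  with \<open>g * h \<in> C\<close> assms(2) have "g * h = 0"
    unfolding is_generator_def by blast
  \<comment> \<open>Exponent vectors carry a linear order compatible with addition, so leading terms
    of nonzero polynomials multiply to a nonzero leading term.\<close>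
  with \<open>g \<noteq> 0\<close> \<open>h \<noteq> 0\<close> show False
    by simp
qed

end
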